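(* (i) For every $n\le 4$ and all $\lambda,\mu\in\mathbb{Z}^n$, every vertex of the Gelfand--Tsetlin polytope $GT(\lambda,\mu)\subset X_n$ has integer coordinates. (ii) For every $n\ge 5$ there exist $\lambda,\mu\in\mathbb{Z}^n$ such that $GT(\lambda,\mu)\subset X_n$ has a vertex with at least one non-integer coordinate. (iii) By choosing $n$ sufficiently large, one can find GT-polytopes in $X_n$ having vertices with arbitrarily large denominators. Explicitly, for every positive integer $k$, let $$\lambda=(\underbrace{k,\dots,k}_{k},\,k-1,\,\underbrace{0,\dots,0}_{k}),\qquad \mu=(\underbrace{k-1,\dots,k-1}_{k+1},\,\underbrace{1,\dots,1}_{k}),$$ both in $\mathbb{Z}^{2k+1}$. Then $GT(\lambda,\mu)\subset X_{2k+1}$ has a vertex that contains entries with denominator $k$ (when written in lowest terms).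
   Context: For $n\in\mathbb{N}$ (with $n \geq 1$), $X_n$ is the real vector space of all triangular arrays $(x_{ij})_{1\le i\le j\le n}$ with $x_{ij}\in\mathbb{R}$, so $X_n \cong \mathbb{R}^{n(n+1)/2}$. A Gelfand--Tsetlin pattern (GT-pattern) is an array $(x_{ij})_{1\le i\le j\le n}\in X_n$ with $x_{ij}\ge 0$ for $1\le i\le j\le n$ and $x_{i,j+1}\ge x_{ij}\ge x_{i+1,j+1}$ for $1\le i\le j\le n-1$. For $\lambda,\mu\in\mathbb{Z}^n$, the Gelfand--Tsetlin polytope (GT-polytope) $GT(\lambda,\mu)\subset X_n$ is the convex polytope of all GT-patterns $(x_{ij})$ with $x_{in}=\lambda_i$ for $1\le i\le n$, $x_{11}=\mu_1$, and $\sum_{i=1}^{j}x_{ij}-\sum_{i=1}^{j-1}x_{i,j-1}=\mu_j$ for $2\le j\le n$. Since $\lambda,\mu$ are integral, vertices of $GT(\lambda,\mu)$ have rational coordinates. The Berenstein--Kirillov conjecture is the assertion that all vertices of every Gelfand--Tsetlin polytope $GT(\lambda,\mu)$ have integer coordinates; parts (i) and (ii) say that it is true for $n\le 4$ and has counterexamples for every $n\ge 5$. *)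

theory Defs
  imports "HOL-Analysis.Analysis" "HOL-Analysis.Finite_Function_Topology"
begin

text \<open>
  The dimension of the space of triangular arrays depends on a natural number that is
  quantified over and instantiated, so all these spaces are realised as linear subspaces of
  the single real vector space of finitely supported functions on pairs of natural numbers:
  an array is a function that vanishes outside the index triangle. Indices are 1-based.
\<close>

definition triangle :: "nat \<Rightarrow> (nat \<times> nat) set" where
  "triangle n = {(i, j). 1 \<le> i \<and> i \<le> j \<and> j \<le> n}"

type_synonym array = "(nat \<times> nat) \<Rightarrow>\<^sub>0 real"

abbreviation entry :: "array \<Rightarrow> nat \<Rightarrow> nat \<Rightarrow> real" where
  "entry x i j \<equiv> Poly_Mapping.lookup x (i, j)"

definition triangular_arrays :: "nat \<Rightarrow> array set" where
  "triangular_arrays n = {x. Poly_Mapping.keys x \<subseteq> triangle n}"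

definition GT_patterns :: "nat \<Rightarrow> array set" where
  "GT_patterns n = {x \<in> triangular_arrays n.
     (\<forall>(i, j) \<in> triangle n. 0 \<le> entry x i j) \<and>
     (\<forall>i j. 1 \<le> i \<and> i \<le> j \<and> j + 1 \<le> n \<longrightarrow>
        entry x i (j + 1) \<ge> entry x i j \<and> entry x i j \<ge> entry x (i + 1) (j + 1))}"

text \<open>
  Integer vectors are lists of length \<open>n\<close>; since list positions start at 0, the component
  with mathematical index \<open>i\<close> is found at position \<open>i - 1\<close>. The set is only meaningful when
  both lists have length \<open>n\<close>.
\<close>

definition GT :: "nat \<Rightarrow> int list \<Rightarrow> int list \<Rightarrow> array set" where
  "GT n lam mu = {x \<in> GT_patterns n.
     (\<forall>i \<in> {1..n}. entry x i n = of_int (lam ! (i - 1))) \<and>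
     entry x 1 1 = of_int (mu ! 0) \<and>
     (\<forall>j \<in> {2..n}.
        (\<Sum>i = 1..j. entry x i j) - (\<Sum>i = 1..j - 1. entry x i (j - 1))
          = of_int (mu ! (j - 1)))}"

definition has_denominator :: "real \<Rightarrow> nat \<Rightarrow> bool" where
  "has_denominator r d \<longleftrightarrow> d > 0 \<and> (\<exists>p::int. coprime p (int d) \<and> r = of_int p / of_nat d)"

end

theory Submission
  imports Defs
begin

text \<open>
  For small \<open>n\<close>, a point is moved by \<open>x \<mapsto> x \<plusminus> \<epsilon> f(x)\<close>, applied entrywise, with \<open>f\<close> vanishing on the
  integers and having zero sum over every row. Equal entries stay equal and the integral ones
  stay fixed, so \<open>f\<close> must vanish on all entries of a vertex. For \<open>n \<le> 4\<close>, any
  non-integral entry admits a nonvanishing such \<open>f\<close>, a signed sum of indicators of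
  entries: equal non-integral entries in a row are excluded, as an integral entry of
  the top row or at \<open>(1, 1)\<close> would lie between them.

  For the counterexamples, a pattern is a vertex as soon as its tight inequalities and the row sums
  determine it. Appending zeros to \<open>\<lambda>\<close> and \<open>\<mu>\<close> preserves this: the sum condition makes the row
  below the new top row equal to \<open>\<lambda>\<close>. So the explicit patterns for \<open>n = 2k + 1\<close> suffice.
\<close>

section \<open>Coordinates of arrays and the polytope described by its row sums\<close>

lemma lookup_scaleR: "Poly_Mapping.lookup (r *\<^sub>R x) k = r *\<^sub>R Poly_Mapping.lookup x k"
proof -
  have "finite {i. r *\<^sub>R Poly_Mapping.lookup x i \<noteq> 0}"
    by (rule finite_subset[OF _ finite_lookup[of x]]) auto
  then show ?thesis by (simp add: scaleR_poly_mapping_def)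
qed

lemma finite_triangle: "finite (triangle n)"
  by (rule finite_subset[of _ "{..n} \<times> {..n}"]) (auto simp: triangle_def)

text \<open>Telescoping the conditions on \<open>\<mu>\<close> prescribes the sum of every row
  separately. In this form all rows are alike, and integrality of each row sum is visible.\<close>

lemma GT_iff:
  assumes "n \<ge> 1"
  shows "x \<in> GT n lam mu \<longleftrightarrow>
     Poly_Mapping.keys x \<subseteq> triangle n \<and> (\<forall>(i, j) \<in> triangle n. 0 \<le> entry x i j) \<and>
     (\<forall>i j. 1 \<le> i \<and> i \<le> j \<and> j + 1 \<le> n \<longrightarrow>
        entry x i (j + 1) \<ge> entry x i j \<and> entry x i j \<ge> entry x (i + 1) (j + 1)) \<and>
     (\<forall>i \<in> {1..n}. entry x i n = of_int (lam ! (i - 1))) \<and>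
     (\<forall>j \<in> {1..n}. (\<Sum>i = 1..j. entry x i j) = of_int (\<Sum>l<j. mu ! l))"
proof -
  let ?S = "\<lambda>j. \<Sum>i = 1..j. entry x i j"
  have "entry x 1 1 = of_int (mu ! 0) \<and>
        (\<forall>j \<in> {2..n}. ?S j - (\<Sum>i = 1..j - 1. entry x i (j - 1)) = of_int (mu ! (j - 1)))
     \<longleftrightarrow> (\<forall>j \<in> {1..n}. ?S j = of_int (\<Sum>l<j. mu ! l))" (is "?L \<longleftrightarrow> ?R")
  proof
    assume L: ?L
    have "j \<in> {1..n} \<longrightarrow> ?S j = of_int (\<Sum>l<j. mu ! l)" for j
    proof (induction j)
      case (Suc j)
      \<comment> \<open>The claim is vacuous at 0, so the induction really starts at row 1, where
        the condition on the entry at (1, 1) supplies it.\<close>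
      show ?case
      proof (cases "j = 0")
        case True
        then show ?thesis using L by simp
      next
        case False
        show ?thesis
        proof
          assume *: "Suc j \<in> {1..n}"
          then have "?S (Suc j) - ?S j = of_int (mu ! j)"
            using False L by (auto dest!: bspec[of _ _ "Suc j"])
          moreover have "?S j = of_int (\<Sum>l<j. mu ! l)" using Suc * False by auto
          ultimately show "?S (Suc j) = of_int (\<Sum>l<Suc j. mu ! l)"
            by (simp del: sum.cl_ivl_Suc add: algebra_simps)
        qed
      qed
    qed simp
    then show ?R by blast
  next
    assume R: ?R
    have "?S j - ?S (j - 1) = of_int (mu ! (j - 1))" if j: "j \<in> {2..n}" for j
    proof -
      obtain m where m: "j = Suc m" using j by (cases j) auto
      have "?S j = of_int (\<Sum>l<j. mu ! l)" "?S m = of_int (\<Sum>l<m. mu ! l)"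
        using j m by (intro R[rule_format]; simp)+
      then show ?thesis by (simp del: sum.cl_ivl_Suc add: m)
    qed
    moreover have "entry x 1 1 = of_int (mu ! 0)"
      using R[rule_format, of 1] assms by simp
    ultimately show ?L by blast
  qed
  then show ?thesis
    unfolding GT_def GT_patterns_def triangular_arrays_def by blast
qed

lemma GT_entry_interlace:
  assumes "x \<in> GT n lam mu" "1 \<le> i" "i \<le> j" "j + 1 \<le> n"
  shows "entry x i j \<le> entry x i (j + 1)" "entry x (i + 1) (j + 1) \<le> entry x i j"
  using assms unfolding GT_def GT_patterns_def by auto

section \<open>Perturbing an extreme point entrywise\<close>

text \<open>For \<open>v < u\<close> the left side tends to 0 with \<open>e\<close> while the right
  side stays positive; for \<open>u = v\<close> both sides are 0. Only finitely many pairs occur, so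
  one \<open>e\<close> serves them all. Both \<open>u + e * f u\<close> and
  \<open>u - e * f u\<close> are then monotone in \<open>u\<close> on \<open>V\<close>.\<close>

lemma small_perturbation_mono:
  fixes f :: "real \<Rightarrow> real"
  assumes "finite V"
  obtains e where "e > 0" "\<And>u v. u \<in> V \<Longrightarrow> v \<in> V \<Longrightarrow> v \<le> u \<Longrightarrow> e * \<bar>f u - f v\<bar> \<le> u - v"
proof -
  have *: "eventually (\<lambda>e. snd p \<le> fst p \<longrightarrow> e * \<bar>f (fst p) - f (snd p)\<bar> \<le> fst p - snd p) (at_right 0)"
    for p :: "real \<times> real"
  proof (cases "snd p < fst p")
    case True
    have "((\<lambda>e. e * \<bar>f (fst p) - f (snd p)\<bar>) \<longlongrightarrow> 0 * \<bar>f (fst p) - f (snd p)\<bar>) (at_right 0)"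
      by (intro tendsto_intros)
    then have "eventually (\<lambda>e. e * \<bar>f (fst p) - f (snd p)\<bar> < fst p - snd p) (at_right 0)"
      using True by (intro order_tendstoD(2)[where y = 0]) auto
    then show ?thesis by (rule eventually_mono) auto
  qed (auto simp: not_less)
  have "eventually (\<lambda>e. \<forall>p\<in>V \<times> V. snd p \<le> fst p \<longrightarrow>
      e * \<bar>f (fst p) - f (snd p)\<bar> \<le> fst p - snd p) (at_right 0)"
    using assms * by (intro eventually_ball_finite) auto
  moreover have "eventually (\<lambda>e::real. e > 0) (at_right 0)"
    by (simp add: eventually_at_filter)
  ultimately have "eventually (\<lambda>e. e > 0 \<and> (\<forall>p\<in>V \<times> V. snd p \<le> fst p \<longrightarrow>
      e * \<bar>f (fst p) - f (snd p)\<bar> \<le> fst p - snd p)) (at_right 0)"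
    by (rule eventually_conj[rotated])
  then obtain e where "e > 0" "\<forall>p\<in>V \<times> V. snd p \<le> fst p \<longrightarrow>
      e * \<bar>f (fst p) - f (snd p)\<bar> \<le> fst p - snd p"
    using eventually_happens'[OF trivial_limit_at_right_real] by blast
  then show ?thesis by (intro that[of e]) auto
qed

text \<open>If \<open>f\<close> were nonzero at some entry, \<open>x\<close> would be the midpoint
  of two distinct points of the polytope. The hypothesis \<open>sums\<close> stops below row
  \<open>n\<close> because the entries of row \<open>n\<close> are integers, where \<open>f\<close>
  vanishes.\<close>

lemma extreme_point_GT_perturbation:
  fixes f :: "real \<Rightarrow> real"
  assumes n: "n \<ge> 1" and ext: "x extreme_point_of GT n lam mu"
    and f_int: "\<And>r. r \<in> \<int> \<Longrightarrow> f r = 0"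
    and sums: "\<And>j. 1 \<le> j \<Longrightarrow> j < n \<Longrightarrow> (\<Sum>i = 1..j. f (entry x i j)) = 0"
  shows "f (entry x i j) = 0"
proof (rule ccontr)
  assume nz: "f (entry x i j) \<noteq> 0"
  have x: "x \<in> GT n lam mu" using ext by (simp add: extreme_point_of_def)
  note X = x[unfolded GT_iff[OF n]]
  have f0: "f 0 = 0" by (simp add: f_int)
  \<comment> \<open>With 0 in \<open>V\<close>, nonnegativity of the perturbed entries is the case
    \<open>v = 0\<close> of monotonicity, and entries outside the support also have their values in
    \<open>V\<close>.\<close>
  define V where "V = insert 0 (Poly_Mapping.lookup x ` Poly_Mapping.keys x)"
  have V: "entry x i j \<in> V" for i j
    unfolding V_def by (cases "(i, j) \<in> Poly_Mapping.keys x") (auto simp: in_keys_iff)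
  have "finite V" by (simp add: V_def)
  from small_perturbation_mono[OF this]
  obtain e where e: "e > 0"
    "\<And>u v. u \<in> V \<Longrightarrow> v \<in> V \<Longrightarrow> v \<le> u \<Longrightarrow> e * \<bar>f u - f v\<bar> \<le> u - v" by metis
  define y where "y c = Poly_Mapping.map (\<lambda>r. r + c * f r) x" for c
  \<comment> \<open>\<open>Poly_Mapping.map\<close> leaves zero entries at zero, which agrees with
    this formula because \<open>f 0 = 0\<close>.\<close>
  have y: "entry (y c) i j = entry x i j + c * f (entry x i j)" for c i j
    unfolding y_def by (simp add: map.rep_eq when_def f0)
  have mono: "v + c * f v \<le> u + c * f u" if "u \<in> V" "v \<in> V" "v \<le> u" "\<bar>c\<bar> = e" for u v c
  proof -
    have "c * (f v - f u) \<le> \<bar>c\<bar> * \<bar>f u - f v\<bar>"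
      by (metis abs_ge_self abs_minus_commute abs_mult)
    also have "\<dots> \<le> u - v" using e(2)[OF that(1-3)] that(4) by simp
    finally show ?thesis by (simp add: algebra_simps)
  qed
  have "y c \<in> GT n lam mu" if c: "\<bar>c\<bar> = e" for c
    unfolding GT_iff[OF n]
  proof (intro conjI ballI allI impI, goal_cases)
    case 1
    have "Poly_Mapping.keys (y c) \<subseteq> Poly_Mapping.keys x"
      by (auto simp: in_keys_iff y_def map.rep_eq when_def split: if_splits)
    then show ?case using X by blast
  next
    case (2 p)
    then obtain a b where p: "p = (a, b)" "0 \<le> entry x a b" using X by (cases p) auto
    then show ?case using mono[OF V _ p(2) c] by (simp add: y f0 V_def)
  next
    case (3 a b)
    then show ?case unfolding y using X by (intro mono V c) auto
  next
    case (4 a b)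
    then show ?case unfolding y using X by (intro mono V c) auto
  next
    case (5 a)
    then have "entry x a n = of_int (lam ! (a - 1))" using X by blast
    then show ?case unfolding y by (simp add: f_int)
  next
    case (6 b)
    have "(\<Sum>a = 1..b. f (entry x a b)) = 0"
    proof (cases "b = n")
      case True
      show ?thesis by (rule sum.neutral) (use X True in \<open>auto simp: f_int\<close>)
    qed (use 6 sums in auto)
    moreover have "(\<Sum>i = 1..b. entry x i b) = of_int (\<Sum>l<b. mu ! l)" using X 6 by blast
    ultimately show ?case unfolding y by (simp add: sum.distrib flip: sum_distrib_left)
  qed
  then have in_GT: "y e \<in> GT n lam mu" "y (-e) \<in> GT n lam mu" using e(1) by auto
  have "x = (1 - 1/2) *\<^sub>R y e + (1/2) *\<^sub>R y (-e)"
    by (rule poly_mapping_eqI) (auto simp: lookup_add lookup_scaleR y field_simps)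
  moreover have "y e \<noteq> y (-e)"
  proof
    assume "y e = y (-e)"
    then have "entry (y e) i j = entry (y (-e)) i j" by simp
    then show False using nz e(1) by (simp add: y)
  qed
  ultimately have "x \<in> open_segment (y e) (y (-e))"
    unfolding in_segment by (metis half_gt_zero_iff zero_less_one field_sum_of_halves less_add_same_cancel1)
  then show False using ext in_GT by (auto simp: extreme_point_of_def)
qed

section \<open>Integrality of vertices in small dimension\<close>

lemma triangle_4_cases:
  assumes "(i, j) \<in> triangle n" "n \<le> 4"
  obtains "j = n" | "i = 1" "j = 1" | "n \<ge> 3" "j = 2" "i \<in> {1, 2}" | "n = 4" "j = 3" "i \<in> {1, 2, 3}"
proof -
  have "1 \<le> i" "i \<le> j" "j \<le> n" "n \<le> 4" using assms by (auto simp: triangle_def)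
  then have "j = n \<or> i = 1 \<and> j = 1 \<or> n \<ge> 3 \<and> j = 2 \<and> (i = 1 \<or> i = 2) \<or>
      n = 4 \<and> j = 3 \<and> (i = 1 \<or> i = 2 \<or> i = 3)"
    by presburger
  then show ?thesis using that by auto
qed

text \<open>Only rows 2 and 3 can lie strictly between the entry at (1, 1) and the top row, so at
  most two zero-sum conditions constrain \<open>f\<close>. Row 2 is settled first; row 3 is then
  treated with row 2 known to be integral.\<close>

lemma extreme_point_GT_le_4_integral:
  assumes n: "1 \<le> n" "n \<le> 4" and ext: "x extreme_point_of GT n lam mu"
    and ij: "(i, j) \<in> triangle n"
  shows "entry x i j \<in> \<int>"
proof -
  have x: "x \<in> GT n lam mu" using ext by (simp add: extreme_point_of_def)
  note X = x[unfolded GT_iff[OF n(1)]]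
  have top: "entry x a n \<in> \<int>" if "1 \<le> a" "a \<le> n" for a using X that by auto
  have row: "(\<Sum>a = 1..b. entry x a b) \<in> \<int>" if "1 \<le> b" "b \<le> n" for b
    using X that by auto
  have x11: "entry x 1 1 \<in> \<int>" using row[of 1] n by simp
  define a b where "a = entry x 1 2" and "b = entry x 2 2"
  define p q r where "p = entry x 1 3" and "q = entry x 2 3" and "r = entry x 3 3"
  have ab: "a + b \<in> \<int>" if "n \<ge> 3"
    using row[of 2] that by (simp add: a_def b_def numeral_2_eq_2)
  \<comment> \<open>Row 1 and the top row are integral, so the conditions on \<open>f\<close> reduce
    to row 2 and, when \<open>n = 4\<close>, row 3.\<close>
  have vanish: "f a = 0 \<and> f b = 0 \<and> (n = 4 \<longrightarrow> f p = 0 \<and> f q = 0 \<and> f r = 0)"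
    if "n \<ge> 3" "\<And>s. s \<in> \<int> \<Longrightarrow> f s = 0" "f a + f b = 0" "n = 4 \<Longrightarrow> f p + f q + f r = 0"
    for f :: "real \<Rightarrow> real"
  proof -
    have "(\<Sum>i = 1..j. f (entry x i j)) = 0" if "1 \<le> j" "j < n" for j
    proof -
      have "j = 1 \<or> j = 2 \<or> j = 3 \<and> n = 4" using that n by linarith
      then consider "j = 1" | "j = 2" | "j = 3" "n = 4" by blast
      then show ?thesis
      proof cases
        case 1
        then show ?thesis using x11 \<open>\<And>s. s \<in> \<int> \<Longrightarrow> f s = 0\<close> by simp
      next
        case 2
        then show ?thesis using \<open>f a + f b = 0\<close> by (simp add: a_def b_def numeral_2_eq_2)
      next
        case 3
        then show ?thesis using \<open>n = 4 \<Longrightarrow> f p + f q + f r = 0\<close>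
          by (simp add: p_def q_def r_def numeral_2_eq_2 numeral_3_eq_3)
      qed
    qed
    then have "f (entry x i j) = 0" for i j
      using extreme_point_GT_perturbation[OF n(1) ext] that(2) by blast
    then show ?thesis by (simp add: a_def b_def p_def q_def r_def)
  qed
  define g :: "real \<Rightarrow> real \<Rightarrow> real" where "g t s = (if s = t then 1 else 0)" for t s
  have g: "g t s = 0" if "t \<notin> \<int>" "s \<in> \<int>" for t s using that by (auto simp: g_def)
  have row3: "p + q + r \<in> \<int>" "r \<le> b" "b \<le> q" "q \<le> a" "a \<le> p"
    "p \<noteq> q \<or> p \<in> \<int>" "q \<noteq> r \<or> q \<in> \<int>" if "n = 4"
  proof -
    show "p + q + r \<in> \<int>"
      using row[of 3] that by (simp add: p_def q_def r_def numeral_2_eq_2 numeral_3_eq_3)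
    have I: "entry x i j \<le> entry x i (Suc j)" "entry x (Suc i) (Suc j) \<le> entry x i j"
      if "1 \<le> i" "i \<le> j" "j \<le> 3" for i j
      using GT_entry_interlace[OF x, of i j] that \<open>n = 4\<close> by auto
    show "r \<le> b" "b \<le> q" "q \<le> a" "a \<le> p"
      using I[of 1 2] I[of 2 2]
      by (simp_all add: a_def b_def p_def q_def r_def numeral_2_eq_2 numeral_3_eq_3)
    have "entry x 2 4 \<le> p" "q \<le> entry x 2 4" "entry x 3 4 \<le> q" "r \<le> entry x 3 4"
      using I[of 1 3] I[of 2 3] I[of 3 3]
      by (simp_all add: p_def q_def r_def eval_nat_numeral)
    moreover have "entry x 2 4 \<in> \<int>" "entry x 3 4 \<in> \<int>" using top[of 2] top[of 3] that by auto
    ultimately show "p \<noteq> q \<or> p \<in> \<int>" "q \<noteq> r \<or> q \<in> \<int>"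
      by (metis order_antisym)+
  qed
  have ab_int: "a \<in> \<int> \<and> b \<in> \<int>" if n3: "n \<ge> 3"
  proof (rule ccontr)
    assume "\<not> (a \<in> \<int> \<and> b \<in> \<int>)"
    \<comment> \<open>The sum \<open>a + b\<close> is an integer, so one non-integral summand forces
      the other to be non-integral.\<close>
    then have frac: "a \<notin> \<int>" "b \<notin> \<int>"
      using ab[OF n3] by (metis Ints_diff add_diff_cancel_left' add_diff_cancel_right')+
    have "b \<le> entry x 1 1" "entry x 1 1 \<le> a"
      using GT_entry_interlace[OF x, of 1 1] n3 by (simp_all add: a_def b_def numeral_2_eq_2)
    then have "a \<noteq> b" using frac x11 by (metis order_antisym)
    show False
    proof (cases "n = 4")
      case False
      then show False
        using vanish[of "\<lambda>s. g a s - g b s"] n3 frac g \<open>a \<noteq> b\<close> by (simp add: g_def)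
    next
      case True
      note R = row3[OF True]
      \<comment> \<open>If \<open>p = q\<close>, then \<open>a\<close> is squeezed to the value
        \<open>p\<close>, which \<open>row3\<close> makes integral. Likewise \<open>q = r\<close>
        would make \<open>b\<close> integral.\<close>
      have "p \<noteq> q" "q \<noteq> r" using R frac by (metis order_antisym)+
      then have "p \<noteq> r" using R by linarith
      note dist = \<open>p \<noteq> q\<close> \<open>q \<noteq> r\<close> \<open>p \<noteq> r\<close> \<open>a \<noteq> b\<close>
      \<comment> \<open>These say whether \<open>a\<close> and \<open>b\<close> occur in row 3: the
        omitted equalities \<open>a = r\<close> and \<open>b = p\<close> would collapse the chain
        \<open>r \<le> b \<le> q \<le> a \<le> p\<close>. As \<open>p\<close>, \<open>q\<close>,
        \<open>r\<close> are distinct, each indicator has sum 0 or 1 over row 3.\<close>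
      define A B where "A \<longleftrightarrow> a = p \<or> a = q" and "B \<longleftrightarrow> b = q \<or> b = r"
      have AB: "a = r \<Longrightarrow> False" "b = p \<Longrightarrow> False" using R dist by linarith+
      \<comment> \<open>The sum of row 3 is an integer, so a non-integral entry cannot be the only
        one.\<close>
      have other: "\<exists>c. c \<notin> \<int> \<and> c \<noteq> t \<and> (c = p \<or> c = q \<or> c = r)"
        if "t \<notin> \<int>" "t = p \<or> t = q \<or> t = r" for t
      proof (rule ccontr)
        assume "\<not> ?thesis"
        then have "\<And>c. c \<noteq> t \<Longrightarrow> c = p \<or> c = q \<or> c = r \<Longrightarrow> c \<in> \<int>" by blast
        then have "p + q + r - t \<in> \<int>" using that(2) dist by (auto simp: Ints_add)
        then have "p + q + r - (p + q + r - t) \<in> \<int>" using Ints_diff[OF R(1)] by blast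
        moreover have "p + q + r - (p + q + r - t) = t" by simp
        ultimately show False using that(1) by metis
      qed
      \<comment> \<open>If \<open>A = B\<close>, then \<open>g a - g b\<close> has sum 0 over both
        rows. If only \<open>a\<close> occurs in row 3, its surplus there is cancelled by another
        non-integral entry \<open>c\<close>; since \<open>b\<close> is absent from row 3,
        \<open>c\<close> differs from both \<open>a\<close> and \<open>b\<close> and leaves the sum
        of row 2 unchanged. The third case is symmetric.\<close>
      consider "A = B" | "A" "\<not> B" | "B" "\<not> A" by blast
      then show False
      proof cases
        case 1
        then have "g a p + g a q + g a r = g b p + g b q + g b r"
          using dist AB unfolding A_def B_def g_def by auto
        then show False
          using vanish[of "\<lambda>s. g a s - g b s"] n3 frac g \<open>a \<noteq> b\<close> by (simp add: g_def)
      next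
        case 2
        then obtain c where c: "c \<notin> \<int>" "c \<noteq> a" "c = p \<or> c = q \<or> c = r"
          using other[of a] frac unfolding A_def by blast
        then have "c \<noteq> b" using 2 AB unfolding B_def by blast
        have "g a p + g a q + g a r = 1" "g b p + g b q + g b r = 0" "g c p + g c q + g c r = 1"
          using dist AB 2 c unfolding A_def B_def g_def by auto
        then show False
          using vanish[of "\<lambda>s. g a s - g b s - g c s"] n3 frac g[of a] g[of b] g[of c]
            \<open>a \<noteq> b\<close> \<open>c \<noteq> b\<close> c by (simp add: g_def)
      next
        case 3
        then obtain c where c: "c \<notin> \<int>" "c \<noteq> b" "c = p \<or> c = q \<or> c = r"
          using other[of b] frac unfolding B_def by blast
        then have "c \<noteq> a" using 3 AB unfolding A_def by blast
        have "g b p + g b q + g b r = 1" "g a p + g a q + g a r = 0" "g c p + g c q + g c r = 1"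
          using dist AB 3 c unfolding A_def B_def g_def by auto
        then show False
          using vanish[of "\<lambda>s. g b s - g a s - g c s"] n3 frac g[of a] g[of b] g[of c]
            \<open>a \<noteq> b\<close> \<open>c \<noteq> a\<close> c by (simp add: g_def)
      qed
    qed
  qed
  have pqr_int: "p \<in> \<int> \<and> q \<in> \<int> \<and> r \<in> \<int>" if n4: "n = 4"
  proof (rule ccontr)
    assume nonint: "\<not> (p \<in> \<int> \<and> q \<in> \<int> \<and> r \<in> \<int>)"
    note R = row3[OF n4]
    \<comment> \<open>Row 2 is now integral, so \<open>g u - g v\<close> vanishes on it. It remains
      to find two distinct non-integral values, each occurring exactly once in row 3; integrality of
      the row sum provides at least two non-integral entries.\<close>
    have "\<exists>u v. u \<notin> \<int> \<and> v \<notin> \<int> \<and> u \<noteq> v \<and> g u p + g u q + g u r = 1 \<and> g v p + g v q + g v r = 1"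
    proof -
      have int2: "c \<in> \<int>" if "c + d + e \<in> \<int>" "d \<in> \<int>" "e \<in> \<int>" for c d e :: real
        using Ints_diff[OF Ints_diff[OF that(1,3)] that(2)] by simp
      have "q + p + r \<in> \<int>" "r + p + q \<in> \<int>" using R(1) by (simp_all add: add_ac)
      then have "p \<notin> \<int> \<and> q \<notin> \<int> \<or> p \<notin> \<int> \<and> q \<in> \<int> \<and> r \<notin> \<int> \<or> q \<notin> \<int> \<and> r \<notin> \<int> \<and> p \<in> \<int>"
        using nonint int2[of p q r] int2[of q p r] int2[of r p q] R(1) by blast
      then consider "p \<notin> \<int>" "q \<notin> \<int>" | "p \<notin> \<int>" "q \<in> \<int>" "r \<notin> \<int>" | "q \<notin> \<int>" "r \<notin> \<int>" "p \<in> \<int>"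
        by blast
      then show ?thesis
      proof cases
        case 1
        then have "p \<noteq> q" "q \<noteq> r" "p \<noteq> r" using R by linarith+
        then show ?thesis using 1 by (intro exI[of _ p] exI[of _ q]) (auto simp: g_def)
      next
        case 2
        then have "p \<noteq> q" "q \<noteq> r" by auto
        moreover have "p \<noteq> r" using calculation R by linarith
        ultimately show ?thesis using 2 by (intro exI[of _ p] exI[of _ r]) (auto simp: g_def)
      next
        case 3
        then have "p \<noteq> q" "q \<noteq> r" "p \<noteq> r" using R by auto
        then show ?thesis using 3 by (intro exI[of _ q] exI[of _ r]) (auto simp: g_def)
      qed
    qed
    then obtain u v where uv: "u \<notin> \<int>" "v \<notin> \<int>" "u \<noteq> v"
      "g u p + g u q + g u r = 1" "g v p + g v q + g v r = 1" by blast
    have "g u s - g v s = 0" if "s = p \<or> s = q \<or> s = r" for s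
      using vanish[of "\<lambda>s. g u s - g v s"] n4 uv g[of u] g[of v] ab_int that by auto
    then have "\<not> (u = p \<or> u = q \<or> u = r)" using uv(3) by (force simp: g_def)
    then show False using uv(4) by (auto simp: g_def)
  qed
  have "n \<ge> 3 \<longrightarrow> a \<in> \<int> \<and> b \<in> \<int>" "n = 4 \<longrightarrow> p \<in> \<int> \<and> q \<in> \<int> \<and> r \<in> \<int>"
    using ab_int pqr_int by auto
  then show ?thesis
    using ij n(2)
    by (cases rule: triangle_4_cases[OF ij n(2)])
       (use top ij in \<open>auto simp: triangle_def a_def b_def p_def q_def r_def x11[simplified]\<close>)
qed

section \<open>Rigid patterns are vertices\<close>

definition array_of :: "nat \<Rightarrow> (nat \<Rightarrow> nat \<Rightarrow> real) \<Rightarrow> array" where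
  "array_of n p = Abs_poly_mapping (\<lambda>(i, j). if (i, j) \<in> triangle n then p i j else 0)"

lemma entry_array_of: "entry (array_of n p) i j = (if (i, j) \<in> triangle n then p i j else 0)"
proof -
  have "finite {ij. (case ij of (i, j) \<Rightarrow> if (i, j) \<in> triangle n then p i j else 0) \<noteq> 0}"
    by (rule finite_subset[OF _ finite_triangle[of n]]) (auto split: if_splits)
  then show ?thesis by (simp add: array_of_def)
qed

text \<open>No nonzero direction \<open>d\<close> keeps the linear equations and all tight interlacing inequalities.\<close>

definition GT_rigid :: "nat \<Rightarrow> array \<Rightarrow> bool" where
  "GT_rigid n x \<longleftrightarrow> (\<forall>d :: nat \<Rightarrow> nat \<Rightarrow> real.
     (\<forall>i\<in>{1..n}. d i n = 0) \<and> (\<forall>j\<in>{1..n}. (\<Sum>i = 1..j. d i j) = 0) \<and>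
     (\<forall>i j. 1 \<le> i \<and> i \<le> j \<and> j + 1 \<le> n \<longrightarrow>
        (entry x i (j + 1) = entry x i j \<longrightarrow> d i (j + 1) = d i j) \<and>
        (entry x i j = entry x (i + 1) (j + 1) \<longrightarrow> d i j = d (i + 1) (j + 1)))
     \<longrightarrow> (\<forall>(i, j)\<in>triangle n. d i j = 0))"

text \<open>If \<open>x\<close> lies strictly between \<open>y\<close> and \<open>z\<close>, every
  interlacing inequality that is tight at \<open>x\<close> is tight at \<open>y\<close>. The
  difference \<open>y - x\<close> is therefore a direction excluded by rigidity, whence
  \<open>y = x\<close> and then \<open>z = y\<close>.\<close>

lemma GT_rigid_imp_extreme_point:
  assumes n: "n \<ge> 1" and x: "x \<in> GT n lam mu" and rigid: "GT_rigid n x"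
  shows "x extreme_point_of GT n lam mu"
  unfolding extreme_point_of_def
proof (intro conjI ballI notI)
  fix y z assume y: "y \<in> GT n lam mu" and z: "z \<in> GT n lam mu" and "x \<in> open_segment y z"
  then obtain u where "y \<noteq> z" and u: "0 < u" "u < 1" "x = (1 - u) *\<^sub>R y + u *\<^sub>R z"
    unfolding in_segment by blast
  have comb: "entry x i j = (1 - u) * entry y i j + u * entry z i j" for i j
    by (simp add: u(3) lookup_add lookup_scaleR)
  have tight: "entry y i j = entry y i' j'"
    if "entry x i j = entry x i' j'" "entry y i j \<le> entry y i' j'" "entry z i j \<le> entry z i' j'"
    for i j i' j'
  proof (rule ccontr)
    assume "entry y i j \<noteq> entry y i' j'"
    then have "(1 - u) * entry y i j < (1 - u) * entry y i' j'" using that u by simp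
    moreover have "u * entry z i j \<le> u * entry z i' j'" using that u by simp
    ultimately show False using that(1) by (simp add: comb)
  qed
  note X = x[unfolded GT_iff[OF n]] and Y = y[unfolded GT_iff[OF n]]
  let ?d = "\<lambda>i j. entry y i j - entry x i j"
  have "\<forall>(i, j)\<in>triangle n. ?d i j = 0"
  proof (rule rigid[unfolded GT_rigid_def, THEN spec, THEN mp], intro conjI ballI allI impI, goal_cases)
    case (1 i)
    then show ?case using X Y by simp
  next
    case (2 j)
    then show ?case using X Y by (simp add: sum_subtractf)
  next
    case (3 i j)
    then show ?case
      using tight[of i j i "j + 1"] GT_entry_interlace[OF y, of i j] GT_entry_interlace[OF z, of i j]
      by simp
  next
    case (4 i j)
    then show ?case
      using tight[of "i + 1" "j + 1" i j] GT_entry_interlace[OF y, of i j]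
        GT_entry_interlace[OF z, of i j] by simp
  qed
  moreover have "entry y i j = entry x i j" if "(i, j) \<notin> triangle n" for i j
  proof -
    have "(i, j) \<notin> Poly_Mapping.keys y" "(i, j) \<notin> Poly_Mapping.keys x" using X Y that by blast+
    then show ?thesis by (simp add: in_keys_iff)
  qed
  ultimately have "entry y i j = entry x i j" for i j
    by (cases "(i, j) \<in> triangle n") auto
  then have "y = x" by (intro poly_mapping_eqI) (metis surj_pair)
  then have "(1 - u) *\<^sub>R y + u *\<^sub>R z = y" using u by simp
  then have "u *\<^sub>R (z - y) = 0" by (simp add: algebra_simps)
  then show False using u \<open>y \<noteq> z\<close> by simp
qed (rule x)

section \<open>Raising the dimension by appending zeros\<close>

text \<open>The new top row is the old one followed by 0, so the row sum does not change, in
  accordance with the 0 appended to \<open>\<mu>\<close>. Each old top entry equals its new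
  neighbour, and these tight inequalities bring the old top row of a direction to 0, where rigidity
  of \<open>x\<close> takes over.\<close>

lemma GT_rigid_append_zero:
  assumes n: "n \<ge> 1" and len: "length lam = n" "length mu = n"
    and x: "x \<in> GT n lam mu" and rigid: "GT_rigid n x"
  obtains y where "y \<in> GT (Suc n) (lam @ [0]) (mu @ [0])" "GT_rigid (Suc n) y"
    "\<And>i j. (i, j) \<in> triangle n \<Longrightarrow> entry y i j = entry x i j"
proof -
  note X = x[unfolded GT_iff[OF n]]
  define p where "p i j = (if j = Suc n then if i \<le> n then entry x i n else 0 else entry x i j)" for i j
  define y where "y = array_of (Suc n) p"
  have y: "entry y i j = p i j" if "(i, j) \<in> triangle (Suc n)" for i j
    using that by (simp add: y_def entry_array_of)
  have y_old: "entry y i j = entry x i j" if "(i, j) \<in> triangle n" for i j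
  proof -
    have "(i, j) \<in> triangle (Suc n)" "j \<noteq> Suc n" using that by (auto simp: triangle_def)
    then show ?thesis by (simp add: y p_def)
  qed
  have y_new: "entry y i (Suc n) = entry x i n" if "1 \<le> i" "i \<le> n" for i
    using y[of i "Suc n"] that by (simp add: triangle_def p_def)
  have y_last: "entry y (Suc n) (Suc n) = 0"
    using y[of "Suc n" "Suc n"] by (simp add: triangle_def p_def)
  have nonneg: "0 \<le> entry x i j" if "1 \<le> i" "i \<le> j" "j \<le> n" for i j
    using X that by (auto simp: triangle_def)
  \<comment> \<open>An entry of row \<open>n - 1\<close> lies between neighbours of row
    \<open>n\<close>. This gives the interlacing of row \<open>n\<close> with its shifted
    copy.\<close>
  have decr: "entry x (i + 1) n \<le> entry x i n" if "1 \<le> i" "i + 1 \<le> n" for i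
  proof -
    have "entry x i (n - 1) \<le> entry x i n" "entry x (i + 1) n \<le> entry x i (n - 1)"
      using GT_entry_interlace[OF x, of i "n - 1"] that by auto
    then show ?thesis by linarith
  qed
  have "y \<in> GT (Suc n) (lam @ [0]) (mu @ [0])"
    unfolding GT_iff[of "Suc n", OF le_SucI[OF n]]
  proof (intro conjI ballI allI impI, goal_cases)
    case 1
    show ?case by (auto simp: in_keys_iff y_def entry_array_of split: if_splits)
  next
    case (2 ij)
    then show ?case by (auto simp: y p_def triangle_def intro!: nonneg)
  next
    case (3 i j)
    show ?case
    proof (cases "j = n")
      case True
      then show ?thesis using 3 y_old[of i n] by (simp add: y_new triangle_def)
    next
      case False
      then have "entry y i j = entry x i j" "entry y i (j + 1) = entry x i (j + 1)"
        using 3 by (auto intro!: y_old simp: triangle_def)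
      then show ?thesis using 3 False X by simp
    qed
  next
    case (4 i j)
    show ?case
    proof (cases "j = n")
      case True
      have "entry y i n = entry x i n" using 4 True by (intro y_old) (simp add: triangle_def)
      then show ?thesis using 4 True decr[of i] y_last nonneg[of n n] y_new[of "i + 1"]
        by (cases "i = n") auto
    next
      case False
      then have "entry y i j = entry x i j" "entry y (i + 1) (j + 1) = entry x (i + 1) (j + 1)"
        using 4 by (auto intro!: y_old simp: triangle_def)
      then show ?thesis using 4 False X by simp
    qed
  next
    case (5 i)
    show ?case
    proof (cases "i = Suc n")
      case False
      then have "entry y i (Suc n) = of_int (lam ! (i - 1))" using y_new[of i] 5 X by simp
      moreover have "i - 1 < n" using 5 False by auto
      ultimately show ?thesis using len by (simp add: nth_append)
    qed (use y_last len in \<open>simp add: nth_append\<close>)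
  next
    case (6 j)
    have old: "(\<Sum>l<m. (mu @ [0]) ! l) = (\<Sum>l<m. mu ! l)" if "m \<le> n" for m
      using that len by (intro sum.cong) (auto simp: nth_append)
    show ?case
    proof (cases "j = Suc n")
      case True
      have "(\<Sum>i = 1..n. entry y i (Suc n)) = (\<Sum>i = 1..n. entry x i n)"
        by (intro sum.cong refl y_new) auto
      also have "\<dots> = of_int (\<Sum>l<n. mu ! l)"
        using X n by (metis atLeastAtMost_iff order_refl)
      finally show ?thesis using y_last old[of n] True len by (simp add: nth_append)
    next
      case False
      have "(\<Sum>i = 1..j. entry y i j) = (\<Sum>i = 1..j. entry x i j)"
        using 6 False by (intro sum.cong refl y_old) (auto simp: triangle_def)
      also have "\<dots> = of_int (\<Sum>l<j. mu ! l)" using X 6 False by auto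
      finally show ?thesis using old[of j] 6 False by simp
    qed
  qed
  moreover have "GT_rigid (Suc n) y"
    unfolding GT_rigid_def
  proof (intro allI impI, elim conjE)
    fix d :: "nat \<Rightarrow> nat \<Rightarrow> real"
    assume top: "\<forall>i\<in>{1..Suc n}. d i (Suc n) = 0"
      and sums: "\<forall>j\<in>{1..Suc n}. (\<Sum>i = 1..j. d i j) = 0"
      and tight: "\<forall>i j. 1 \<le> i \<and> i \<le> j \<and> j + 1 \<le> Suc n \<longrightarrow>
        (entry y i (j + 1) = entry y i j \<longrightarrow> d i (j + 1) = d i j) \<and>
        (entry y i j = entry y (i + 1) (j + 1) \<longrightarrow> d i j = d (i + 1) (j + 1))"
    have row_n: "d i n = 0" if "1 \<le> i" "i \<le> n" for i
      using tight[rule_format, of i n] top y_new[of i] y_old[of i n] that by (simp add: triangle_def)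
    have "\<forall>(i, j)\<in>triangle n. d i j = 0"
    proof (rule rigid[unfolded GT_rigid_def, THEN spec, THEN mp], intro conjI ballI allI impI, goal_cases)
      case (3 i j)
      then show ?case using tight[rule_format, of i j] y_old[of i j] y_old[of i "j + 1"]
        by (simp add: triangle_def)
    next
      case (4 i j)
      then show ?case using tight[rule_format, of i j] y_old[of i j] y_old[of "i + 1" "j + 1"]
        by (simp add: triangle_def)
    qed (use row_n sums in auto)
    then show "\<forall>(i, j)\<in>triangle (Suc n). d i j = 0"
      using top by (auto simp: triangle_def le_Suc_eq)
  qed
  ultimately show ?thesis using y_old by (rule that)
qed

lemma GT_rigid_append_zeros:
  assumes "n \<ge> 1" "length lam = n" "length mu = n" "x \<in> GT n lam mu" "GT_rigid n x"
  shows "\<exists>y. y \<in> GT (n + m) (lam @ replicate m 0) (mu @ replicate m 0) \<and> GT_rigid (n + m) y \<and>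
    (\<forall>(i, j)\<in>triangle n. entry y i j = entry x i j)"
proof (induction m)
  case 0
  then show ?case using assms by auto
next
  case (Suc m)
  then obtain y where y: "y \<in> GT (n + m) (lam @ replicate m 0) (mu @ replicate m 0)"
    "GT_rigid (n + m) y" "\<forall>(i, j)\<in>triangle n. entry y i j = entry x i j" by blast
  from GT_rigid_append_zero[OF _ _ _ y(1,2)]
  obtain z where z: "z \<in> GT (Suc (n + m)) ((lam @ replicate m 0) @ [0]) ((mu @ replicate m 0) @ [0])"
    "GT_rigid (Suc (n + m)) z" "\<And>i j. (i, j) \<in> triangle (n + m) \<Longrightarrow> entry z i j = entry y i j"
    using assms by auto
  moreover have "triangle n \<subseteq> triangle (n + m)" by (auto simp: triangle_def)
  ultimately show ?case using y(3)
    by (intro exI[of _ z]) (auto simp: replicate_append_same)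
qed

section \<open>The explicit pattern with denominator \<open>k\<close>\<close>

text \<open>
  Three families of entries are tied to the integral top row: the \<open>k\<close>s, the zeros at
  \<open>i > k + 1\<close> and the entry at \<open>(k + 1, k + 1)\<close>. The entries \<open>(k\<^sup>2 - 1) / k\<close> form a single
  connected tile filling the rest of row \<open>k + 1\<close>, whose sum is \<open>k\<^sup>2 - 1\<close>; this forces their
  common value. Every other row has just one further entry, which its row sum determines.
\<close>

definition fractional_pattern :: "nat \<Rightarrow> nat \<Rightarrow> nat \<Rightarrow> real" where
  "fractional_pattern k i j =
     (if i > k + 1 then 0
      else if i = k + 1 then (real j - k - 1) * (real k - 1) / k
      else if i = j then (real k - 1) * (real k + 1 - j) / k
      else if i + k + 1 \<le> j then k
      else (real k ^ 2 - 1) / k)"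

text \<open>Over the common denominator \<open>k\<close>, the numerators are 0,
  \<open>k * k\<close>, or multiples of \<open>m = k - 1\<close>. All comparisons follow from
  monotonicity of multiplication by \<open>m\<close> and from
  \<open>m * (k + 1) = k * k - 1\<close>.\<close>

lemma fractional_pattern_interlace:
  assumes "k \<ge> 1" "1 \<le> i" "i \<le> j" "j \<le> 2 * k"
  shows "fractional_pattern k i j \<le> fractional_pattern k i (j + 1)"
    "fractional_pattern k (i + 1) (j + 1) \<le> fractional_pattern k i j"
proof -
  define m where "m = real k - 1"
  have k: "real k = m + 1" "m \<ge> 0" using assms(1) by (auto simp: m_def)
  have sq: "(real k ^ 2 - 1) = m * (real k + 1)" by (simp add: k power2_eq_square algebra_simps)
  have A: "m * a \<le> m * b" if "a \<le> b" for a b using that k by (simp add: mult_left_mono)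
  have B: "m * a \<le> real k * real k" if "a \<le> real k + 1" for a
    using A[OF that] by (simp add: k algebra_simps)
  have C: "0 \<le> m * a" if "0 \<le> a" for a using that k by simp
  have pos: "real k > 0" using assms(1) by simp
  have eq: "fractional_pattern k i j =
     (if i > k + 1 then 0
      else if i = k + 1 then m * (real j - k - 1)
      else if i = j then m * (real k + 1 - j)
      else if i + k + 1 \<le> j then real k * real k
      else m * (real k + 1)) / k" for i j
    using pos sq by (simp add: fractional_pattern_def m_def mult.commute)
  show "fractional_pattern k i j \<le> fractional_pattern k i (j + 1)"
    unfolding eq using pos assms by (intro divide_right_mono) (auto intro!: A B C k(2))
  show "fractional_pattern k (i + 1) (j + 1) \<le> fractional_pattern k i j"
    unfolding eq using pos assms by (intro divide_right_mono) (auto intro!: A B C k(2))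
qed

text \<open>The right side is the sum of the first \<open>j\<close> entries of the prescribed
  \<open>\<mu>\<close>.\<close>

lemma fractional_pattern_row_sum:
  assumes "k \<ge> 1" "1 \<le> j" "j \<le> 2 * k + 1"
  shows "(\<Sum>i = 1..j. fractional_pattern k i j) =
    (if j \<le> k + 1 then real j * (real k - 1) else real k ^ 2 - 1 + (real j - k - 1))"
proof (cases "j \<le> k")
  case True
  have "{1..j} = insert j {1..<j}" using assms by auto
  then have "(\<Sum>i = 1..j. fractional_pattern k i j) =
      fractional_pattern k j j + (\<Sum>i = 1..<j. fractional_pattern k i j)" by simp
  also have "(\<Sum>i = 1..<j. fractional_pattern k i j) = (\<Sum>i = 1..<j. (real k ^ 2 - 1) / k)"
    by (rule sum.cong) (use True in \<open>auto simp: fractional_pattern_def\<close>)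
  also have "fractional_pattern k j j + \<dots> = real j * (real k - 1)"
    using True assms by (simp add: fractional_pattern_def of_nat_diff field_simps power2_eq_square)
  finally show ?thesis using True by simp
next
  case False
  \<comment> \<open>From left to right: the entries \<open>k\<close>, the tile, the single
    correcting entry in position \<open>k + 1\<close>, and the zeros.\<close>
  have "{1..j} = {1..j - k - 1} \<union> {j - k..k} \<union> {k + 1} \<union> {k + 2..j}" using assms False by auto
  then have "(\<Sum>i = 1..j. fractional_pattern k i j) =
      (\<Sum>i \<in> {1..j - k - 1} \<union> {j - k..k} \<union> {k + 1} \<union> {k + 2..j}. fractional_pattern k i j)"
    by simp
  also have "\<dots> = (\<Sum>i = 1..j - k - 1. fractional_pattern k i j) +
      (\<Sum>i = j - k..k. fractional_pattern k i j) + fractional_pattern k (k + 1) j +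
      (\<Sum>i = k + 2..j. fractional_pattern k i j)"
    using False assms by (subst sum.union_disjoint; auto)+
  also have "(\<Sum>i = 1..j - k - 1. fractional_pattern k i j) = (\<Sum>i = 1..j - k - 1. real k)"
    by (rule sum.cong) (use assms in \<open>auto simp: fractional_pattern_def\<close>)
  also have "(\<Sum>i = j - k..k. fractional_pattern k i j) = (\<Sum>i = j - k..k. (real k ^ 2 - 1) / k)"
    by (rule sum.cong) (use False in \<open>auto simp: fractional_pattern_def\<close>)
  also have "(\<Sum>i = k + 2..j. fractional_pattern k i j) = 0"
    by (rule sum.neutral) (auto simp: fractional_pattern_def)
  also have "(\<Sum>i = 1..j - k - 1. real k) + (\<Sum>i = j - k..k. (real k ^ 2 - 1) / k) +
      fractional_pattern k (k + 1) j + 0 = real k ^ 2 - 1 + (real j - k - 1)"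
    using False assms by (simp add: fractional_pattern_def of_nat_diff field_simps power2_eq_square)
  finally have "(\<Sum>i = 1..j. fractional_pattern k i j) = real k ^ 2 - 1 + (real j - k - 1)" .
  \<comment> \<open>At \<open>j = k + 1\<close> the two formulas agree, since
    \<open>(k + 1) * (k - 1) = k ^ 2 - 1\<close>.\<close>
  moreover have "j = k + 1" if "j \<le> k + 1" using False that by simp
  ultimately show ?thesis by (auto simp: power2_eq_square algebra_simps)
qed

lemma fractional_pattern_in_GT:
  assumes k: "k \<ge> 1"
  shows "array_of (2 * k + 1) (fractional_pattern k) \<in> GT (2 * k + 1)
    (replicate k (int k) @ [int k - 1] @ replicate k 0)
    (replicate (k + 1) (int k - 1) @ replicate k 1)"
    (is "?x \<in> GT ?n ?lam ?mu")
proof -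
  have x: "entry ?x i j = fractional_pattern k i j" if "(i, j) \<in> triangle ?n" for i j
    using that by (simp add: entry_array_of)
  have n: "1 \<le> ?n" by simp
  show ?thesis
    unfolding GT_iff[OF n]
  proof (intro conjI ballI allI impI, goal_cases)
    case 1
    show ?case by (auto simp: in_keys_iff entry_array_of split: if_splits)
  next
    case (2 ij)
    then obtain i j where ij: "ij = (i, j)" "1 \<le> i" "i \<le> j" "j \<le> ?n" by (auto simp: triangle_def)
    have "1 \<le> real k ^ 2" using k by (simp add: one_le_power)
    then have "0 \<le> fractional_pattern k i j"
      using ij k by (auto simp: fractional_pattern_def not_less)
    then show ?case using 2 x ij by auto
  next
    case (3 i j)
    then show ?case using fractional_pattern_interlace(1)[OF k, of i j] x[of i j] x[of i "j + 1"]
      by (simp add: triangle_def)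
  next
    case (4 i j)
    then show ?case using fractional_pattern_interlace(2)[OF k, of i j] x[of i j] x[of "i + 1" "j + 1"]
      by (simp add: triangle_def)
  next
    case (5 i)
    then have "entry ?x i ?n = fractional_pattern k i ?n" by (intro x) (auto simp: triangle_def)
    moreover consider "i \<le> k" | "i = k + 1" | "i > k + 1" by linarith
    then have "fractional_pattern k i ?n = of_int (?lam ! (i - 1))"
    proof cases
      case 1
      then have "i - 1 < k" using k 5 by auto
      then show ?thesis using 1 by (simp add: fractional_pattern_def nth_append)
    next
      case 2
      then show ?thesis using k by (simp add: fractional_pattern_def nth_append)
    next
      case 3
      then obtain m where "i = k + 2 + m" using le_Suc_ex[of "k + 2" i] by auto
      then show ?thesis using 5 by (simp add: fractional_pattern_def nth_append)
    qed
    ultimately show ?case by simp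
  next
    case (6 j)
    have "(\<Sum>i = 1..j. entry ?x i j) = (\<Sum>i = 1..j. fractional_pattern k i j)"
      using 6 by (intro sum.cong refl x) (auto simp: triangle_def)
    also have "\<dots> = (if j \<le> k + 1 then real j * (real k - 1) else real k ^ 2 - 1 + (real j - k - 1))"
      using 6 by (intro fractional_pattern_row_sum k) auto
    also have "\<dots> = of_int (\<Sum>l<j. ?mu ! l)"
    proof (cases "j \<le> k + 1")
      case True
      have "(\<Sum>l<j. ?mu ! l) = (\<Sum>l<j. int k - 1)"
        using True by (intro sum.cong) (auto simp: nth_append simp del: replicate_Suc)
      then show ?thesis using True by simp
    next
      case False
      have "(\<Sum>l<j. ?mu ! l) = (\<Sum>l<k + 1. ?mu ! l) + (\<Sum>l = k + 1..<j. ?mu ! l)"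
        unfolding lessThan_atLeast0 using False by (intro sum.atLeastLessThan_concat[symmetric]) auto
      also have "(\<Sum>l<k + 1. ?mu ! l) = (\<Sum>l<k + 1. int k - 1)"
        by (rule sum.cong) (auto simp: nth_append simp del: replicate_Suc)
      also have "(\<Sum>l = k + 1..<j. ?mu ! l) = (\<Sum>l = k + 1..<j. 1)"
      proof (rule sum.cong)
        fix l assume "l \<in> {k + 1..<j}"
        then have "k + 1 \<le> l" "l - (k + 1) < k" using 6 by auto
        then show "?mu ! l = 1" by (simp add: nth_append del: replicate_Suc)
      qed simp
      finally have "(\<Sum>l<j. ?mu ! l) = int (k + 1) * (int k - 1) + (int j - int k - 1)"
        using False by (simp add: of_nat_diff)
      then have "real_of_int (\<Sum>l<j. ?mu ! l) = of_int (int (k + 1) * (int k - 1) + (int j - int k - 1))"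
        by (rule arg_cong)
      also have "\<dots> = real k ^ 2 - 1 + (real j - k - 1)"
        by (simp add: power2_eq_square algebra_simps)
      finally show ?thesis using False by (simp only: if_False)
    qed
    finally show ?case .
  qed
qed

lemma fractional_pattern_rigid:
  assumes k: "k \<ge> 1"
  shows "GT_rigid (2 * k + 1) (array_of (2 * k + 1) (fractional_pattern k))"
    (is "GT_rigid ?n ?x")
  unfolding GT_rigid_def
proof (intro allI impI, elim conjE)
  fix d :: "nat \<Rightarrow> nat \<Rightarrow> real"
  assume top: "\<forall>i\<in>{1..?n}. d i ?n = 0" and sums: "\<forall>j\<in>{1..?n}. (\<Sum>i = 1..j. d i j) = 0"
    and tight: "\<forall>i j. 1 \<le> i \<and> i \<le> j \<and> j + 1 \<le> ?n \<longrightarrow>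
        (entry ?x i (j + 1) = entry ?x i j \<longrightarrow> d i (j + 1) = d i j) \<and>
        (entry ?x i j = entry ?x (i + 1) (j + 1) \<longrightarrow> d i j = d (i + 1) (j + 1))"
  have col: "d i (Suc j) = d i j"
    if "1 \<le> i" "i \<le> j" "j \<le> 2 * k" "fractional_pattern k i (Suc j) = fractional_pattern k i j" for i j
    using tight[rule_format, of i j] that by (simp add: entry_array_of triangle_def)
  have diag: "d i j = d (Suc i) (Suc j)"
    if "1 \<le> i" "i \<le> j" "j \<le> 2 * k"
      "fractional_pattern k i j = fractional_pattern k (Suc i) (Suc j)" for i j
    using tight[rule_format, of i j] that by (simp add: entry_array_of triangle_def)
  have right: "d i j = 0" if "k + 1 < i" "i \<le> j" "j \<le> ?n" for i j
    \<comment> \<open>The induction descends from the top row, here along diagonals and in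
      \<open>left\<close> with \<open>i\<close> fixed.\<close>
    using that(3,1,2)
  proof (induction j arbitrary: i rule: inc_induct)
    case base
    then show ?case using top by auto
  next
    case (step j)
    then have "d i j = d (Suc i) (Suc j)" by (intro diag) (auto simp: fractional_pattern_def)
    then show ?case using step by auto
  qed
  have left: "d i j = 0" if "1 \<le> i" "i + k + 1 \<le> j" "j \<le> ?n" for i j
    using that(3,1,2)
  proof (induction j rule: inc_induct)
    case base
    then show ?case using top by auto
  next
    case (step j)
    then have "d i (Suc j) = d i j" by (intro col) (auto simp: fractional_pattern_def)
    then show ?case using step by auto
  qed
  \<comment> \<open>The pattern is 0 at this position and at its diagonal neighbour
    (\<open>k + 2\<close>, \<open>k + 2\<close>), which belongs to the zeros already
    treated.\<close>
  have corner: "d (k + 1) (k + 1) = 0"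
    using diag[of "k + 1" "k + 1"] right[of "k + 2" "k + 2"] k by (simp add: fractional_pattern_def)
  \<comment> \<open>The tile is connected: its entries next to the main diagonal are linked along
    that diagonal, and each remaining one is reached from there by increasing
    \<open>j\<close>.\<close>
  have diagonal: "d i (i + 1) = d 1 2" if "1 \<le> i" "i \<le> k" for i
    using that
  proof (induction i rule: dec_induct)
    case (step i)
    then have "d i (Suc i) = d (Suc i) (Suc (Suc i))"
      by (intro diag) (auto simp: fractional_pattern_def)
    then show ?case using step by simp
  qed (simp add: numeral_2_eq_2)
  have middle: "d i j = d 1 2" if "1 \<le> i" "i \<le> k" "i + 1 \<le> j" "j \<le> i + k" for i j
    using that(3,4)
  proof (induction j rule: dec_induct)
    case base
    then show ?case using diagonal that by simp
  next
    case (step j)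
    then have "d i (Suc j) = d i j" using that by (intro col) (auto simp: fractional_pattern_def)
    then show ?case using step by simp
  qed
  have "(\<Sum>i = 1..k + 1. d i (k + 1)) = 0" using sums k by (intro sums[rule_format]) simp
  moreover have "(\<Sum>i = 1..k. d i (k + 1)) = (\<Sum>i = 1..k. d 1 2)"
    by (intro sum.cong refl middle) auto
  ultimately have "real k * d 1 2 = 0" using corner by simp
  then have "d 1 2 = 0" using k by simp
  \<comment> \<open>The excluded position is the one free entry of row \<open>j\<close>: the
    diagonal one for \<open>j \<le> k\<close>, and the one with \<open>i = k + 1\<close>
    afterwards.\<close>
  then have most: "d i j = 0" if "1 \<le> i" "i \<le> j" "j \<le> ?n" "i \<noteq> min j (k + 1)" for i j
    using middle[of i j] left[of i j] right[of i j] that by linarith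
  have "d i j = 0" if ij: "1 \<le> i" "i \<le> j" "j \<le> ?n" for i j
  proof (cases "i = min j (k + 1)")
    case True
    have "0 = (\<Sum>i = 1..j. d i j)" using sums ij by simp
    also have "\<dots> = d i j + (\<Sum>i \<in> {1..j} - {i}. d i j)" using ij by (intro sum.remove) auto
    also have "(\<Sum>i \<in> {1..j} - {i}. d i j) = 0"
      using ij True by (intro sum.neutral ballI most) auto
    finally show ?thesis by simp
  qed (use most ij in blast)
  then show "\<forall>(i, j)\<in>triangle ?n. d i j = 0" by (auto simp: triangle_def)
qed

text \<open>The position (\<open>k\<close>, \<open>2 * k\<close>) lies in the tile, and a common
  divisor of \<open>k ^ 2 - 1\<close> and \<open>k\<close> divides 1.\<close>

lemma fractional_pattern_has_denominator:
  assumes k: "k \<ge> 1"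
  shows "has_denominator (fractional_pattern k k (2 * k)) k"
proof -
  have "coprime (int k ^ 2 - 1) (int k)"
  proof (rule coprimeI)
    fix c assume c: "c dvd int k ^ 2 - 1" "c dvd int k"
    then have "c dvd int k ^ 2" by (simp add: power2_eq_square)
    from dvd_diff[OF this c(1)] have "c dvd int k ^ 2 - (int k ^ 2 - 1)" .
    moreover have "int k ^ 2 - (int k ^ 2 - 1) = 1" by (simp del: of_nat_power)
    ultimately show "is_unit c" by metis
  qed
  then show ?thesis using k unfolding has_denominator_def
    by (auto simp: fractional_pattern_def intro!: exI[of _ "int k ^ 2 - 1"])
qed

lemma has_denominator_not_Ints:
  assumes "has_denominator r d" "d \<ge> 2"
  shows "r \<notin> \<int>"
proof
  assume "r \<in> \<int>"
  then obtain m where m: "r = of_int m" by (auto elim: Ints_cases)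
  obtain p where p: "coprime p (int d)" "r = of_int p / of_nat d"
    using assms(1) by (auto simp: has_denominator_def)
  then have "real_of_int p = of_int (m * int d)" using m assms(2) by (simp add: field_simps)
  then have "p = m * int d" by (simp only: of_int_eq_iff)
  then have "int d dvd p" by simp
  then have "is_unit (int d)" using p(1) by (metis coprime_common_divisor dvd_refl)
  then show False using assms(2) by simp
qed

section \<open>Vertices with prescribed denominators and the final assembly\<close>

text \<open>Padding the explicit pattern with \<open>n - (2 * k + 1)\<close> zeros keeps its old
  entries. This serves both the non-integral vertices and the unbounded denominators.\<close>

lemma extreme_point_GT_with_denominator:
  assumes "k \<ge> 1" "n \<ge> 2 * k + 1"
  shows "\<exists>lam mu x. length lam = n \<and> length mu = n \<and> x extreme_point_of GT n lam mu \<and>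
    (\<exists>(i, j) \<in> triangle n. has_denominator (entry x i j) k)"
proof -
  let ?N = "2 * k + 1"
  let ?lam = "replicate k (int k) @ [int k - 1] @ replicate k 0"
  let ?mu = "replicate (k + 1) (int k - 1) @ replicate k 1"
  have len: "length ?lam = ?N" "length ?mu = ?N" by auto
  have N: "1 \<le> ?N" by simp
  obtain m where m: "n = ?N + m" using assms(2) le_Suc_ex by blast
  obtain y where y: "y \<in> GT n (?lam @ replicate m 0) (?mu @ replicate m 0)" "GT_rigid n y"
    "\<forall>(i, j)\<in>triangle ?N. entry y i j = entry (array_of ?N (fractional_pattern k)) i j"
    using GT_rigid_append_zeros[OF N len fractional_pattern_in_GT[OF assms(1)]
      fractional_pattern_rigid[OF assms(1)], of m] m by blast
  have tri: "(k, 2 * k) \<in> triangle ?N" "(k, 2 * k) \<in> triangle n"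
    using assms by (auto simp: triangle_def)
  then have "entry y k (2 * k) = fractional_pattern k k (2 * k)"
    using y(3) by (auto simp: entry_array_of)
  then have "has_denominator (entry y k (2 * k)) k"
    using fractional_pattern_has_denominator[OF assms(1)] by simp
  moreover have "y extreme_point_of GT n (?lam @ replicate m 0) (?mu @ replicate m 0)"
    using GT_rigid_imp_extreme_point[OF _ y(1,2)] m by simp
  moreover have "length (?lam @ replicate m 0) = n" "length (?mu @ replicate m 0) = n"
    using m by auto
  ultimately show ?thesis using tri(2) by blast
qed

theorem theorem1p7:
  shows
    "(\<forall>n lam mu x. 1 \<le> n \<and> n \<le> 4 \<and> length lam = n \<and> length mu = n \<and>
        x extreme_point_of GT n lam mu \<longrightarrow>
        (\<forall>(i, j) \<in> triangle n. entry x i j \<in> \<int>))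
     \<and>
     (\<forall>n\<ge>5. \<exists>lam mu x. length lam = n \<and> length mu = n \<and>
        x extreme_point_of GT n lam mu \<and>
        (\<exists>(i, j) \<in> triangle n. entry x i j \<notin> \<int>))
     \<and>
     (\<forall>D. \<exists>N\<ge>1. \<forall>n\<ge>N. \<exists>lam mu x. length lam = n \<and> length mu = n \<and>
        x extreme_point_of GT n lam mu \<and>
        (\<exists>(i, j) \<in> triangle n. \<exists>d\<ge>D. has_denominator (entry x i j) d))
     \<and>
     (\<forall>k\<ge>1.
        let lam = replicate k (int k) @ [int k - 1] @ replicate k 0;
            mu = replicate (k + 1) (int k - 1) @ replicate k 1
        in \<exists>x. x extreme_point_of GT (2 * k + 1) lam mu \<and>
             (\<exists>(i, j) \<in> triangle (2 * k + 1). has_denominator (entry x i j) k))"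
proof (intro conjI allI impI)
  show "\<forall>(i, j) \<in> triangle n. entry x i j \<in> \<int>"
    if "1 \<le> n \<and> n \<le> 4 \<and> length lam = n \<and> length mu = n \<and> x extreme_point_of GT n lam mu"
    for n lam mu x
    using extreme_point_GT_le_4_integral that by blast
next
  fix n :: nat assume "n \<ge> 5"
  \<comment> \<open>Denominator 2 is available from \<open>2 * 2 + 1 = 5\<close> onwards.\<close>
  then show "\<exists>lam mu x. length lam = n \<and> length mu = n \<and> x extreme_point_of GT n lam mu \<and>
      (\<exists>(i, j) \<in> triangle n. entry x i j \<notin> \<int>)"
    using extreme_point_GT_with_denominator[of 2 n] has_denominator_not_Ints[of _ 2] by fastforce
next
  fix D :: nat
  show "\<exists>N\<ge>1. \<forall>n\<ge>N. \<exists>lam mu x. length lam = n \<and> length mu = n \<and>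
      x extreme_point_of GT n lam mu \<and>
      (\<exists>(i, j) \<in> triangle n. \<exists>d\<ge>D. has_denominator (entry x i j) d)"
  \<comment> \<open>The maximum keeps the denominator positive when \<open>D = 0\<close>.\<close>
  proof (intro exI[of _ "2 * max 1 D + 1"] conjI allI impI)
    fix n assume "2 * max 1 D + 1 \<le> n"
    from extreme_point_GT_with_denominator[OF _ this]
    obtain lam mu x i j where "length lam = n" "length mu = n" "x extreme_point_of GT n lam mu"
      "(i, j) \<in> triangle n" "has_denominator (entry x i j) (max 1 D)" by auto
    moreover have "max 1 D \<ge> D" by simp
    ultimately show "\<exists>lam mu x. length lam = n \<and> length mu = n \<and>
      x extreme_point_of GT n lam mu \<and>
      (\<exists>(i, j) \<in> triangle n. \<exists>d\<ge>D. has_denominator (entry x i j) d)" by blast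
  qed simp
next
  fix k :: nat assume k: "k \<ge> 1"
  let ?x = "array_of (2 * k + 1) (fractional_pattern k)"
  have tri: "(k, 2 * k) \<in> triangle (2 * k + 1)" using k by (simp add: triangle_def)
  then have "has_denominator (entry ?x k (2 * k)) k"
    using fractional_pattern_has_denominator[OF k] by (simp add: entry_array_of)
  moreover have "1 \<le> 2 * k + 1" by simp
  note GT_rigid_imp_extreme_point[OF this fractional_pattern_in_GT[OF k] fractional_pattern_rigid[OF k]]
  ultimately show "let lam = replicate k (int k) @ [int k - 1] @ replicate k 0;
            mu = replicate (k + 1) (int k - 1) @ replicate k 1
        in \<exists>x. x extreme_point_of GT (2 * k + 1) lam mu \<and>
             (\<exists>(i, j) \<in> triangle (2 * k + 1). has_denominator (entry x i j) k)"
    unfolding Let_def using tri by blast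
qed

end
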